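(* Let $M$ be a sparse paving matroid. Then $M$ is cyclically orderable if and only if, for every nonempty subset $A$ of $E(M)$, $r(M)\,|A|\leq r(A)\,|E(M)|$.
   Context: A matroid $M$ of rank $r$ is sparse paving if every nonspanning circuit is a hyperplane; equivalently, every $r$-subset of $E(M)$ is a basis or a circuit-hyperplane. A matroid $M$ is cyclically orderable if there is a cyclic ordering $(a_1,a_2,\dots,a_n)$ of $E(M)$ in which every set of $r(M)$ cyclically-consecutive elements is a basis of $M$. Here $r(A)$ denotes the rank of $A$ in $M$. *)

theory Defs
  imports Main
begin

definition matroid :: "'a set \<Rightarrow> ('a set \<Rightarrow> bool) \<Rightarrow> bool" where
  "matroid E indep \<longleftrightarrow>
     finite E \<and> indep {} \<and>
     (\<forall>X. indep X \<longrightarrow> X \<subseteq> E) \<and>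
     (\<forall>X Y. indep X \<and> Y \<subseteq> X \<longrightarrow> indep Y) \<and>
     (\<forall>X Y. indep X \<and> indep Y \<and> card X < card Y \<longrightarrow>
        (\<exists>y \<in> Y - X. indep (insert y X)))"

definition mrank :: "('a set \<Rightarrow> bool) \<Rightarrow> 'a set \<Rightarrow> nat" where
  "mrank indep A = Max {card X | X. X \<subseteq> A \<and> indep X}"

definition basis :: "'a set \<Rightarrow> ('a set \<Rightarrow> bool) \<Rightarrow> 'a set \<Rightarrow> bool" where
  "basis E indep B \<longleftrightarrow> indep B \<and> (\<forall>X. indep X \<and> B \<subseteq> X \<longrightarrow> X = B)"

definition circuit :: "'a set \<Rightarrow> ('a set \<Rightarrow> bool) \<Rightarrow> 'a set \<Rightarrow> bool" where
  "circuit E indep C \<longleftrightarrow> C \<subseteq> E \<and> \<not> indep C \<and> (\<forall>x \<in> C. indep (C - {x}))"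

definition flat :: "'a set \<Rightarrow> ('a set \<Rightarrow> bool) \<Rightarrow> 'a set \<Rightarrow> bool" where
  "flat E indep F \<longleftrightarrow> F \<subseteq> E \<and> (\<forall>x \<in> E - F. mrank indep (insert x F) > mrank indep F)"

definition hyperplane :: "'a set \<Rightarrow> ('a set \<Rightarrow> bool) \<Rightarrow> 'a set \<Rightarrow> bool" where
  "hyperplane E indep H \<longleftrightarrow> flat E indep H \<and> mrank indep H + 1 = mrank indep E"

definition sparse_paving :: "'a set \<Rightarrow> ('a set \<Rightarrow> bool) \<Rightarrow> bool" where
  "sparse_paving E indep \<longleftrightarrow>
     (\<forall>C. circuit E indep C \<and> mrank indep C < mrank indep E \<longrightarrow> hyperplane E indep C)"

definition cyclically_orderable :: "'a set \<Rightarrow> ('a set \<Rightarrow> bool) \<Rightarrow> bool" where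
  "cyclically_orderable E indep \<longleftrightarrow>
     (\<exists>xs. distinct xs \<and> set xs = E \<and>
        (\<forall>i < length xs. basis E indep
            {xs ! ((i + j) mod length xs) | j. j < mrank indep E}))"

end

theory Submission
  imports Defs "HOL-Combinatorics.Permutations"
begin

text \<open>The inequality is necessary by double counting the incidences between \<open>A\<close> and the bases given by
  the arcs. For the converse, two dependent \<open>r\<close>-sets of a sparse paving matroid never differ by a
  single exchange, and the inequality for one such set forces \<open>2 \<le> r \<le> n - 2\<close>. Take a cyclic ordering
  with the fewest dependent arcs and suppose that one is left. Place a window of four consecutive
  positions with two of them inside that arc. Permuting the window changes only the six arcs that
  meet it partially, and by sparsity some permutation makes all six independent: contradiction.
  If \<open>r = 2\<close> or \<open>n = r + 2\<close>, a window of three positions does.\<close>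

section \<open>Rearranging a short window\<close>

text \<open>\<open>P S\<close> will mean that the arc meeting the window \<open>W\<close> in \<open>S\<close> is dependent when \<open>S\<close> fills the
  positions at one end of \<open>W\<close>. The clause relating \<open>U\<close> to \<open>insert x U\<close> reflects that the larger trace
  belongs to an arc with one element fewer outside \<open>W\<close>, so the two arcs differ by an exchange; for
  \<open>U = {}\<close> this could fail because the arcs involved may overlap around the cycle.\<close>

definition sparse_on :: "'a set \<Rightarrow> ('a set \<Rightarrow> bool) \<Rightarrow> bool" where
  "sparse_on W P \<longleftrightarrow>
     (\<forall>U x. x \<notin> U \<and> insert x U \<subset> W \<and> P (insert x U) \<longrightarrow>
        (\<forall>y \<in> W - insert x U. \<not> P (insert y U)) \<and> (U \<noteq> {} \<longrightarrow> \<not> P U))"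

lemma sparse_on_siblings:
  assumes "sparse_on W P" "x \<in> W - U" "y \<in> W - U" "x \<noteq> y" "U \<subseteq> W" "P (insert x U)"
  shows "\<not> P (insert y U)"
proof -
  have "insert x U \<subset> W" "y \<in> W - insert x U" using assms by auto
  with assms show ?thesis unfolding sparse_on_def by blast
qed

lemma sparse_on_subset:
  assumes "sparse_on W P" "x \<notin> U" "insert x U \<subset> W" "U \<noteq> {}" "P (insert x U)"
  shows "\<not> P U"
  using assms unfolding sparse_on_def by blast

text \<open>\<open>P\<close> governs the initial segments of the arrangement and \<open>Q\<close>
  the final ones. Nothing relates \<open>P\<close> to \<open>Q\<close>: sparsity of each on its own
  already forbids so few sets that one of the 24 arrangements avoids them all.\<close>

lemma window_of_four:
  assumes d: "distinct [a,b,c,d]" and W: "W = {a,b,c,d}"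
    and P: "sparse_on W P" and Q: "sparse_on W Q"
  shows "\<exists>x y z u. distinct [x,y,z,u] \<and> {x,y,z,u} = W \<and>
    \<not> P {x} \<and> \<not> P {x,y} \<and> \<not> P {x,y,z} \<and> \<not> Q {u} \<and> \<not> Q {z,u} \<and> \<not> Q {y,z,u}"
proof (rule ccontr)
  assume neg: "\<not> ?thesis"
  have cW: "card W = 4" using d W by simp
  have dist: "distinct [x,y,z,u]" if "{x,y,z,u} = W" for x y z u
  proof (rule card_distinct)
    have "set [x,y,z,u] = W" using that by (simp only: list.set)
    then have "card (set [x,y,z,u]) = 4" using cW by (simp only:)
    then show "card (set [x,y,z,u]) = length [x,y,z,u]" by (simp only: list.size)
  qed
  have all: "P {x} \<or> P {x,y} \<or> P {x,y,z} \<or> Q {u} \<or> Q {z,u} \<or> Q {y,z,u}"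
    if "{x,y,z,u} = W" for x y z u
    using neg[unfolded not_ex, rule_format, of x y z u] dist[OF that] that by argo
  \<comment> \<open>The instances of sparsity that matter: siblings of sizes 1, 2 and 3, and nested
    pairs of sizes 1, 2 and 2, 3.\<close>
  have s: "(\<not> R {x} \<or> \<not> R {y}) \<and> (\<not> R {y,x} \<or> \<not> R {z,x}) \<and>
      (\<not> R {z,x,y} \<or> \<not> R {u,x,y}) \<and> (\<not> R {x} \<or> \<not> R {y,x}) \<and> (\<not> R {x,y} \<or> \<not> R {z,x,y})"
    if "{x,y,z,u} = W" "sparse_on W R" for x y z u R
  proof (intro conjI)
    note sib = sparse_on_siblings[OF that(2)] and sub = sparse_on_subset[OF that(2)]
    have ne: "x \<noteq> y" "x \<noteq> z" "x \<noteq> u" "y \<noteq> z" "y \<noteq> u" "z \<noteq> u"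
      using dist[OF that(1)] by auto
    have mem: "x \<in> W" "y \<in> W" "z \<in> W" "u \<in> W" using that(1) by blast+
    have ps: "{y,x} \<subset> W" "{z,x,y} \<subset> W" using mem ne by blast+
    show "\<not> R {x} \<or> \<not> R {y}" using sib[of x "{}" y] ne mem by simp
    show "\<not> R {y,x} \<or> \<not> R {z,x}" using sib[of y "{x}" z] ne mem by simp
    show "\<not> R {z,x,y} \<or> \<not> R {u,x,y}" using sib[of z "{x,y}" u] ne mem by simp
    show "\<not> R {x} \<or> \<not> R {y,x}" using sub[of y "{x}"] ne ps(1) by auto
    show "\<not> R {x,y} \<or> \<not> R {z,x,y}" using sub[of z "{x,y}"] ne ps(2) by auto
  qed
  have perms: "{x,y,z,u} = W" if "{x,y,z,u} = {a,b,c,d}" for x y z u using that W by simp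
  note A = all[OF perms] s[OF perms P] s[OF perms Q]
  \<comment> \<open>Each subset occurs here in several spellings. Ordered rewriting with
    \<open>insert_commute\<close> leaves one of them, so that every subset becomes a single
    atom.\<close>
  note inst = A[of a b c d] A[of a b d c] A[of a c b d] A[of a c d b] A[of a d b c] A[of a d c b]
      A[of b a c d] A[of b a d c] A[of b c a d] A[of b c d a] A[of b d a c] A[of b d c a]
      A[of c b a d] A[of c b d a] A[of c a b d] A[of c a d b] A[of c d b a] A[of c d a b]
      A[of d b c a] A[of d b a c] A[of d c b a] A[of d c a b] A[of d a b c] A[of d a c b]
  txt \<open>The failure of all 24 arrangements contradicts sparsity by propositional reasoning alone.\<close>
  show False using inst[simplified insert_commute refl] by sat
qed

section \<open>Cyclic orderings avoiding a sparse family\<close>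

text \<open>A cyclic ordering is an \<open>n\<close>-periodic function on the integers, so that every arc is the image
  of an honest interval.\<close>

locale sparse_family =
  fixes E :: "'a set" and H :: "'a set set" and n r :: int
  assumes finite_E: "finite E" and n_def: "n = int (card E)"
    and sparse: "\<And>x y U. x \<notin> U \<Longrightarrow> y \<notin> U \<Longrightarrow> x \<noteq> y \<Longrightarrow> insert x U \<in> H \<Longrightarrow> insert y U \<notin> H"
    and r_ge: "2 \<le> r" and n_ge: "r + 2 \<le> n"
begin

definition ordering :: "(int \<Rightarrow> 'a) \<Rightarrow> bool" where
  "ordering f \<longleftrightarrow> (\<forall>x. f (x mod n) = f x) \<and> bij_betw f {0..<n} E"

definition defects :: "(int \<Rightarrow> 'a) \<Rightarrow> nat" where
  "defects f = card {i \<in> {0..<n}. f ` {i..<i + r} \<in> H}"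

text \<open>The window starts at position 0. Once the elements at the positions \<open>S\<close>
  have been moved to its front, an arc ending right after them consists of these and of the
  \<open>r - card S\<close> positions left of 0. \<open>suffix_bad\<close> is the mirror image for a
  window of length \<open>w\<close>.\<close>

definition prefix_bad :: "(int \<Rightarrow> 'a) \<Rightarrow> int set \<Rightarrow> bool" where
  "prefix_bad f S \<longleftrightarrow> f ` (S \<union> {int (card S) - r..<0}) \<in> H"

definition suffix_bad :: "(int \<Rightarrow> 'a) \<Rightarrow> int \<Rightarrow> int set \<Rightarrow> bool" where
  "suffix_bad f w S \<longleftrightarrow> f ` (S \<union> {w..<w - int (card S) + r}) \<in> H"

section \<open>Periodic orderings, their arcs and their rotations\<close>

lemma n_pos: "n > 0" using r_ge n_ge by simp

lemma ordering_mod: "ordering f \<Longrightarrow> f (x mod n) = f x"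
  by (simp add: ordering_def)

lemma ordering_cong:
  assumes "ordering f" "x mod n = y mod n" shows "f x = f y"
  using ordering_mod[OF assms(1), of x] ordering_mod[OF assms(1), of y] assms(2) by simp

lemma mod_bij: "bij_betw (\<lambda>x. x mod n) {s..<s + n} {0..<n}"
proof (rule bij_betwI[where g = "\<lambda>y. s + (y - s) mod n"])
  have b: "0 \<le> x mod n" "x mod n < n" for x using n_pos by simp_all
  show "(\<lambda>x. x mod n) \<in> {s..<s + n} \<rightarrow> {0..<n}" using b by simp
  show "(\<lambda>y. s + (y - s) mod n) \<in> {0..<n} \<rightarrow> {s..<s + n}" using b by simp
  fix x assume "x \<in> {s..<s + n}"
  then have "(x - s) mod n = x - s" by (intro mod_pos_pos_trivial) auto
  then show "s + (x mod n - s) mod n = x" by (simp only: mod_diff_left_eq)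
next
  fix y assume "y \<in> {0..<n}"
  then have "y mod n = y" by (intro mod_pos_pos_trivial) auto
  moreover have "(s + (y - s) mod n) mod n = (s + (y - s)) mod n" by (rule mod_add_right_eq)
  ultimately show "(s + (y - s) mod n) mod n = y" by simp
qed

lemma ordering_bij:
  assumes "ordering f" shows "bij_betw f {s..<s + n} E"
proof -
  have "bij_betw (f \<circ> (\<lambda>x. x mod n)) {s..<s + n} E"
    using mod_bij assms bij_betw_trans unfolding ordering_def by blast
  moreover have "f \<circ> (\<lambda>x. x mod n) = f" using ordering_mod[OF assms] by auto
  ultimately show ?thesis by simp
qed

lemma ordering_inj:
  assumes "ordering f" "S \<subseteq> {s..<s + n}" shows "inj_on f S"
  using ordering_bij[OF assms(1), of s] assms(2) by (meson bij_betw_def inj_on_subset)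

lemma arc_mod:
  assumes "ordering f" shows "f ` {i mod n..<i mod n + r} = f ` {i..<i + r}"
proof -
  have "i mod n + i div n * n = i" by simp
  then have "(\<lambda>x. x + i div n * n) ` {i mod n..<i mod n + r} = {i..<i + r}"
    unfolding image_add_atLeastLessThan' by (simp only: add.commute[of _ r] add.assoc)
  then have "{i..<i + r} = (\<lambda>x. x + i div n * n) ` {i mod n..<i mod n + r}" ..
  then have "f ` {i..<i + r} = (\<lambda>x. f (x + i div n * n)) ` {i mod n..<i mod n + r}"
    by (simp only: image_image)
  also have "\<dots> = f ` {i mod n..<i mod n + r}"
    by (intro image_cong refl ordering_cong[OF assms]) simp
  finally show ?thesis by simp
qed

text \<open>Arcs depend only on their start modulo \<open>n\<close>, so any full period may be used
  for counting. The period from \<open>1 - r\<close> suits a window placed at 0.\<close>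

lemma defects_shift:
  assumes "ordering f"
  shows "defects f = card {i \<in> {s..<s + n}. f ` {i..<i + r} \<in> H}"
proof -
  have "(\<lambda>x. x mod n) ` {i \<in> {s..<s + n}. f ` {i..<i + r} \<in> H}
      = {i \<in> {0..<n}. f ` {i..<i + r} \<in> H}" (is "?m ` ?A = ?B")
  proof
    show "?m ` ?A \<subseteq> ?B" using arc_mod[OF assms] n_pos by auto
    show "?B \<subseteq> ?m ` ?A"
    proof
      fix i assume i: "i \<in> ?B"
      then obtain x where "x \<in> {s..<s + n}" "i = x mod n"
        using mod_bij[of s] unfolding bij_betw_def by blast
      with i show "i \<in> ?m ` ?A" using arc_mod[OF assms, of x] by auto
    qed
  qed
  moreover have "inj_on ?m ?A"
    using mod_bij[of s] unfolding bij_betw_def by (auto intro: inj_on_subset)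
  ultimately show ?thesis unfolding defects_def using card_image[of ?m ?A] by simp
qed

lemma arc_rotate: "(\<lambda>x. f (x + s)) ` {i..<i + r} = f ` {i + s..<i + s + r}" for f :: "int \<Rightarrow> 'a"
proof -
  have "{i + s..<i + s + r} = (\<lambda>x. x + s) ` {i..<i + r}" by (simp add: algebra_simps)
  then show ?thesis by (simp only: image_image)
qed

lemma ordering_rotate:
  assumes "ordering f"
  shows "ordering (\<lambda>x. f (x + s))" "defects (\<lambda>x. f (x + s)) = defects f"
proof -
  have "bij_betw (f \<circ> (\<lambda>x. x + s)) {0..<n} E"
    by (rule bij_betw_trans[OF _ ordering_bij[OF assms, of s]])
      (auto simp: bij_betw_def)
  moreover have "f (x mod n + s) = f (x + s)" for x
    by (rule ordering_cong[OF assms]) (simp add: mod_add_left_eq)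
  ultimately show "ordering (\<lambda>x. f (x + s))" by (simp add: ordering_def o_def)
  have "defects (\<lambda>x. f (x + s)) = card {i \<in> {0..<n}. f ` {i + s..<i + s + r} \<in> H}"
    by (simp add: defects_def arc_rotate)
  also have "\<dots> = card {i \<in> {s..<s + n}. f ` {i..<i + r} \<in> H}"
  proof (rule bij_betw_same_card[where f = "\<lambda>i. i + s"])
    show "bij_betw (\<lambda>i. i + s) {i \<in> {0..<n}. f ` {i + s..<i + s + r} \<in> H}
       {i \<in> {s..<s + n}. f ` {i..<i + r} \<in> H}"
      by (rule bij_betwI[where g = "\<lambda>i. i - s"]) auto
  qed
  also have "\<dots> = defects f" using defects_shift[OF assms] by simp
  finally show "defects (\<lambda>x. f (x + s)) = defects f" .
qed

section \<open>Windows: sparsity of their traces, and permutations that remove defects\<close>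

lemma ordering_sparse:
  assumes "ordering f" "x \<notin> U" "y \<notin> U" "x \<noteq> y" "insert x (insert y U) \<subseteq> {s..<s + n}"
    "f ` insert x U \<in> H"
  shows "f ` insert y U \<notin> H"
proof -
  have inj: "inj_on f (insert x (insert y U))" using ordering_inj assms by blast
  have "f x \<notin> f ` U" "f y \<notin> f ` U" "f x \<noteq> f y"
    using inj assms(2-4) by (auto simp: inj_on_def)
  then show ?thesis using sparse[of "f x" "f ` U" "f y"] assms(6) by simp
qed

text \<open>Traces of equal size are completed by the same positions left of 0, and a trace with one
  position more gives up the leftmost of them. Either way the arcs differ by one exchange. The
  bounds on \<open>w\<close> make all positions involved fit into the period from
  \<open>1 - r\<close>.\<close>

lemma sparse_prefix:
  assumes f: "ordering f" and w: "w \<le> r + 1" "w + r \<le> n + 1"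
  shows "sparse_on {0..<w} (prefix_bad f)"
  unfolding sparse_on_def
proof (intro allI impI conjI ballI; elim conjE)
  fix U x
  assume x: "x \<notin> U" "insert x U \<subset> {0..<w}" "prefix_bad f (insert x U)"
  have "U \<subseteq> {0..<w}" using x(2) by blast
  then have fin: "finite U" by (rule finite_subset) simp
  define k where "k = int (card U)"
  have "card (insert x U) < card {0..<w}" using x(2) by (intro psubset_card_mono) auto
  then have k: "k + 1 < w" using fin x(1) by (simp add: k_def)
  have k0: "k \<ge> 0" by (simp add: k_def)
  have c: "int (card (insert y U)) = k + 1" if "y \<notin> U" for y
    using fin that by (simp add: k_def)
  have bx: "f ` insert x (U \<union> {k + 1 - r..<0}) \<in> H"
    using x(3) c[OF x(1)] by (simp add: prefix_bad_def)
  {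
    fix y assume y: "y \<in> {0..<w} - insert x U"
    have "f ` insert y (U \<union> {k + 1 - r..<0}) \<notin> H"
      by (rule ordering_sparse[where s = "1 - r", OF f _ _ _ _ bx]) (use x y k k0 w in auto)
    then show "\<not> prefix_bad f (insert y U)"
      using c[of y] y by (simp add: prefix_bad_def)
  next
    assume U: "U \<noteq> {}"
    \<comment> \<open>Nonemptiness of \<open>U\<close> keeps the position \<open>k - r\<close>
      inside the period from \<open>1 - r\<close>. For \<open>k = 0\<close> it would be
      \<open>-r\<close>, which coincides modulo \<open>n\<close> with the last window position if
      \<open>w + r = n + 1\<close>.\<close>
    have k1: "k \<ge> 1" using U fin by (simp add: k_def Suc_leI card_gt_0_iff)
    have "f ` insert (k - r) (U \<union> {k + 1 - r..<0}) \<notin> H"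
      by (rule ordering_sparse[where s = "1 - r", OF f _ _ _ _ bx]) (use x k k1 w in auto)
    moreover have "insert (k - r) (U \<union> {k + 1 - r..<0}) = U \<union> {k - r..<0}" using k w by auto
    ultimately show "\<not> prefix_bad f U" by (simp only: prefix_bad_def k_def not_False_eq_True)
  }
qed

text \<open>Mirror image of \<open>sparse_prefix\<close>: a larger trace gives up the rightmost
  position beyond the window, and the relevant period starts at 0.\<close>

lemma sparse_suffix:
  assumes f: "ordering f" and w: "w \<le> r + 1" "w + r \<le> n + 1"
  shows "sparse_on {0..<w} (suffix_bad f w)"
  unfolding sparse_on_def
proof (intro allI impI conjI ballI; elim conjE)
  fix U x
  assume x: "x \<notin> U" "insert x U \<subset> {0..<w}" "suffix_bad f w (insert x U)"
  have "U \<subseteq> {0..<w}" using x(2) by blast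
  then have fin: "finite U" by (rule finite_subset) simp
  define k where "k = int (card U)"
  have "card (insert x U) < card {0..<w}" using x(2) by (intro psubset_card_mono) auto
  then have k: "k + 1 < w" using fin x(1) by (simp add: k_def)
  have k0: "k \<ge> 0" by (simp add: k_def)
  have c: "int (card (insert y U)) = k + 1" if "y \<notin> U" for y
    using fin that by (simp add: k_def)
  have bx: "f ` insert x (U \<union> {w..<w - (k + 1) + r}) \<in> H"
    using x(3) c[OF x(1)] by (simp add: suffix_bad_def)
  {
    fix y assume y: "y \<in> {0..<w} - insert x U"
    have "f ` insert y (U \<union> {w..<w - (k + 1) + r}) \<notin> H"
      by (rule ordering_sparse[where s = 0, OF f _ _ _ _ bx]) (use x y k k0 w in auto)
    then show "\<not> suffix_bad f w (insert y U)"
      using c[of y] y by (simp add: suffix_bad_def)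
  next
    assume U: "U \<noteq> {}"
    have k1: "k \<ge> 1" using U fin by (simp add: k_def Suc_leI card_gt_0_iff)
    have "f ` insert (w - (k + 1) + r) (U \<union> {w..<w - (k + 1) + r}) \<notin> H"
      by (rule ordering_sparse[where s = 0, OF f _ _ _ _ bx]) (use x k k1 w in auto)
    moreover have "insert (w - (k + 1) + r) (U \<union> {w..<w - (k + 1) + r}) = U \<union> {w..<w - k + r}"
      using k w by auto
    ultimately show "\<not> suffix_bad f w U" by (simp only: suffix_bad_def k_def not_False_eq_True)
  }
qed

text \<open>An arc that contains or misses the window keeps its set of elements under
  \<open>p\<close>. Every other arc ends or starts strictly inside the window and is made good by
  \<open>good\<close>. Hence no defect arises, and the one ending at \<open>k\<close>
  disappears.\<close>

lemma rearrange_window: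
  assumes f: "ordering f" and w: "1 \<le> w" "w \<le> r + 1" "w + r \<le> n + 1"
    and p: "p permutes {0..<w}"
    and good: "\<And>j. j \<in> {1..<w} \<Longrightarrow> \<not> prefix_bad f (p ` {0..<j}) \<and> \<not> suffix_bad f w (p ` {j..<w})"
    and k: "k \<in> {1..<w}" "f ` {k - r..<k} \<in> H"
  shows "\<exists>g. ordering g \<and> defects g < defects f"
proof (intro exI conjI)
  let ?g = "\<lambda>x. f (p (x mod n))"
  have inj: "inj p" using p by (simp add: permutes_inj)
  have p_out: "p x = x" if "x \<notin> {0..<w}" for x using p that by (simp add: permutes_not_in)
  have wn: "w \<le> n" using w r_ge by simp
  have "p permutes {0..<n}" using p wn by (auto intro: permutes_subset)
  then have "bij_betw (f \<circ> p) {0..<n} E"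
    using f unfolding ordering_def by (meson bij_betw_trans permutes_imp_bij)
  then have "bij_betw ?g {0..<n} E"
    by (rule bij_betw_cong[THEN iffD1, rotated]) auto
  then show g: "ordering ?g" by (simp add: ordering_def)
  \<comment> \<open>\<open>?g\<close> applies the periodic extension of \<open>p\<close>. Since
    \<open>w - n \<le> 1 - r\<close>, this range avoids all translates of the window except the
    window itself, so \<open>p\<close> alone suffices.\<close>
  have g_eq: "?g x = f (p x)" if "x \<in> {1 - r..<n}" for x
  proof (cases "0 \<le> x")
    case True then show ?thesis using that by simp
  next
    case False
    have "x mod n = (x + n) mod n" by simp
    also have "\<dots> = x + n" using that False n_ge r_ge by (intro mod_pos_pos_trivial) auto
    finally have xn: "x mod n = x + n" .
    have "p (x + n) = x + n" using that w by (intro p_out) auto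
    then have "?g x = f (x + n)" using xn by simp
    also have "\<dots> = f x" by (rule ordering_cong[OF f]) simp
    also have "\<dots> = f (p x)" using False p_out[of x] by simp
    finally show ?thesis .
  qed
  have g_img: "?g ` S = f ` p ` S" if "S \<subseteq> {1 - r..<n}" for S
    unfolding image_image using that by (intro image_cong refl g_eq) auto
  have p_id: "p ` S = S" if "S \<inter> {0..<w} = {}" for S
    using that p_out by (force simp: image_iff)
  have card_p: "card (p ` S) = card S" for S
    using inj by (simp add: card_image inj_on_subset)
  have bad_prefix: "?g ` {j - r..<j} \<notin> H" if j: "j \<in> {1..<w}" for j
  proof -
    have "{j - r..<j} = {0..<j} \<union> {j - r..<0}" using j w by auto
    then have "?g ` {j - r..<j} = f ` (p ` {0..<j} \<union> p ` {j - r..<0})"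
      using j w by (subst g_img) (auto simp: image_Un)
    also have "p ` {j - r..<0} = {j - r..<0}" by (rule p_id) auto
    finally show ?thesis using good[OF j] j by (auto simp: prefix_bad_def card_p)
  qed
  have bad_suffix: "?g ` {j..<j + r} \<notin> H" if j: "j \<in> {1..<w}" for j
  proof -
    have "{j..<j + r} = {j..<w} \<union> {w..<j + r}" using j w by auto
    then have "?g ` {j..<j + r} = f ` (p ` {j..<w} \<union> p ` {w..<j + r})"
      using j w by (subst g_img) (auto simp: image_Un)
    also have "p ` {w..<j + r} = {w..<j + r}" by (rule p_id) auto
    finally show ?thesis using good[OF j] j by (auto simp: suffix_bad_def card_p)
  qed
  have neutral: "?g ` {i..<i + r} = f ` {i..<i + r}"
    if i: "w - r \<le> i" "i \<le> 0 \<or> w \<le> i" "i \<le> n - r" for i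
  proof -
    have "p ` {i..<i + r} = {i..<i + r}"
    proof (cases "w \<le> i")
      case True then show ?thesis by (intro p_id) auto
    next
      case False
      then have "{i..<i + r} = {0..<w} \<union> ({i..<0} \<union> {w..<i + r})" using i w by auto
      moreover have "p ` ({i..<0} \<union> {w..<i + r}) = {i..<0} \<union> {w..<i + r}" by (rule p_id) auto
      ultimately show ?thesis using permutes_image[OF p] by (metis image_Un)
    qed
    moreover have "{i..<i + r} \<subseteq> {1 - r..<n}" using i w by auto
    ultimately show ?thesis using g_img by metis
  qed
  \<comment> \<open>Starts below \<open>w - r\<close> give arcs ending inside the window; then, up
    to 0, arcs containing it; then, below \<open>w\<close>, arcs starting inside it; the rest miss
    it.\<close>
  let ?I = "{1 - r..<1 - r + n}"
  have sub: "{i \<in> ?I. ?g ` {i..<i + r} \<in> H} \<subseteq> {i \<in> ?I. f ` {i..<i + r} \<in> H}"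
  proof safe
    fix i assume i: "i \<in> ?I" "?g ` {i..<i + r} \<in> H"
    have "\<not> i < w - r" using bad_prefix[of "i + r"] i by auto
    moreover have "\<not> (1 \<le> i \<and> i < w)" using bad_suffix[of i] i by auto
    ultimately show "f ` {i..<i + r} \<in> H" using neutral[of i] i by fastforce
  qed
  moreover have "k - r \<in> {i \<in> ?I. f ` {i..<i + r} \<in> H}" using k w by auto
  moreover have "k - r \<notin> {i \<in> ?I. ?g ` {i..<i + r} \<in> H}" using bad_prefix[OF k(1)] by auto
  ultimately have "{i \<in> ?I. ?g ` {i..<i + r} \<in> H} \<subset> {i \<in> ?I. f ` {i..<i + r} \<in> H}" by blast
  then have "card {i \<in> ?I. ?g ` {i..<i + r} \<in> H} < card {i \<in> ?I. f ` {i..<i + r} \<in> H}"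
    by (rule psubset_card_mono[rotated]) (rule finite_Collect_conjI, simp)
  then show "defects ?g < defects f"
    using defects_shift[OF g, of "1 - r"] defects_shift[OF f, of "1 - r"] by simp
qed

text \<open>The two inequalities are the bounds of \<open>rearrange_window\<close> for
  \<open>w = 4\<close>; the bad arc covers the first two window positions, hence
  \<open>k = 2\<close>.\<close>

lemma reduce_wide:
  assumes f: "ordering f" and wide: "3 \<le> r" "r + 3 \<le> n" and bad: "f ` {2 - r..<2} \<in> H"
  shows "\<exists>g. ordering g \<and> defects g < defects f"
proof -
  have W: "{0..<4::int} = {0,1,2,3}" by auto
  obtain x y z u where d: "distinct [x,y,z,u]" and eq: "{x,y,z,u} = {0..<4::int}"
    and P: "\<not> prefix_bad f {x}" "\<not> prefix_bad f {x,y}" "\<not> prefix_bad f {x,y,z}"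
    and Q: "\<not> suffix_bad f 4 {u}" "\<not> suffix_bad f 4 {z,u}" "\<not> suffix_bad f 4 {y,z,u}"
    using window_of_four[OF _ W sparse_prefix[OF f, of 4] sparse_suffix[OF f, of 4]] wide
    by auto
  define p where "p i = (if i = 0 then x else if i = 1 then y else if i = 2 then z
      else if i = 3 then u else i)" for i :: int
  have img: "p ` {0,1,2,3} = {x,y,z,u}" by (auto simp: p_def)
  have "inj_on p {0..<4}" unfolding W using d by (auto simp: p_def inj_on_def)
  then have "p permutes {0..<4}"
    by (intro bij_imp_permutes) (use img eq W in \<open>auto simp: bij_betw_def p_def\<close>)
  moreover have "\<not> prefix_bad f (p ` {0..<j}) \<and> \<not> suffix_bad f 4 (p ` {j..<4})"
    if "j \<in> {1..<4}" for j
  proof -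
    have sets: "{0..<1::int} = {0}" "{0..<2::int} = {0,1}" "{0..<3::int} = {0,1,2}"
      "{1..<4::int} = {1,2,3}" "{2..<4::int} = {2,3}" "{3..<4::int} = {3}" by auto
    have "j = 1 \<or> j = 2 \<or> j = 3" using that by auto
    then show ?thesis using P Q by (elim disjE) (simp_all add: sets p_def insert_commute)
  qed
  ultimately show ?thesis
    by (rule rearrange_window[OF f, where k = 2, rotated 3]) (use wide bad in auto)
qed

text \<open>When \<open>r = 2\<close> or \<open>n = r + 2\<close> a window of four is too long, but the families of bad prefixes and
  bad suffixes of a window of three then interact.\<close>

lemma reduce_narrow:
  assumes f: "ordering f" and narrow: "r = 2 \<or> n = r + 2" and bad: "f ` {2 - r..<2} \<in> H"
  shows "\<exists>g. ordering g \<and> defects g < defects f"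
proof -
  have W: "{0..<3::int} = {0,1,2}" by auto
  have sP: "sparse_on {0,1,2} (prefix_bad f)" and sQ: "sparse_on {0,1,2} (suffix_bad f 3)"
    using sparse_prefix[OF f, of 3] sparse_suffix[OF f, of 3] r_ge n_ge W by auto
  have "{2 - r..<2} = {0,1} \<union> {2 - r..<0}" using r_ge by auto
  then have P01: "prefix_bad f {0,1}" using bad by (simp add: prefix_bad_def)
  have ps: "{1,0} \<subset> {0,1,2::int}" "{0,1} \<subset> {0,1,2::int}"
    by (auto simp: psubset_eq dest: equalityD2)
  have P0: "\<not> prefix_bad f {0}"
    using sparse_on_subset[OF sP _ ps(1)] P01 by (simp add: insert_commute)
  have P1: "\<not> prefix_bad f {1}"
    using sparse_on_subset[OF sP _ ps(2)] P01 by simp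
  have P02: "\<not> prefix_bad f {0,2}"
    using sparse_on_siblings[OF sP, of 1 "{0}" 2] P01 by (auto simp: insert_commute)
  have P12: "\<not> prefix_bad f {1,2}"
    using sparse_on_siblings[OF sP, of 0 "{1}" 2] P01 by (auto simp: insert_commute)
  \<comment> \<open>The arc for the suffix \<open>{a}\<close> arises from the bad arc by exchanging
    \<open>b\<close> for 3: the remaining parts \<open>{2 - r..<0}\<close> and
    \<open>{4..<2 + r}\<close> are both empty if \<open>r = 2\<close> and are translates by
    \<open>n\<close> if \<open>n = r + 2\<close>.\<close>
  have Q: "\<not> suffix_bad f 3 {a}" if ab: "a = 0 \<and> b = 1 \<or> a = 1 \<and> b = 0" for a b :: int
  proof -
    have "f ` ({0,1} \<union> {2 - r..<0}) = f ` insert b (insert a {4..<2 + r})"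
    proof (cases "r = 2")
      case True then show ?thesis using ab by auto
    next
      case False
      then have "{4..<2 + r} = (\<lambda>x. x + n) ` {2 - r..<0}" using narrow by (simp add: add.commute)
      moreover have "f (x + n) = f x" for x by (rule ordering_cong[OF f]) simp
      ultimately have "f ` {4..<2 + r} = f ` {2 - r..<0}" by (simp only: image_image)
      then show ?thesis using ab by (auto simp: image_Un)
    qed
    then have "f ` insert b (insert a {4..<2 + r}) \<in> H" using P01 by (simp add: prefix_bad_def)
    then have "f ` insert 3 (insert a {4..<2 + r}) \<notin> H"
      by (intro ordering_sparse[where s = 0, OF f]) (use ab n_ge r_ge in auto)
    moreover have "insert 3 (insert a {4..<2 + r}) = {a} \<union> {3..<2 + r}" using r_ge by auto
    ultimately show ?thesis by (simp add: suffix_bad_def)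
  qed
  have Q02: "\<not> suffix_bad f 3 {0,2} \<or> \<not> suffix_bad f 3 {1,2}"
    using sparse_on_siblings[OF sQ, of 0 "{2}" 1] by (auto simp: insert_commute)
  \<comment> \<open>The new arrangement is \<open>x\<close>, 2, \<open>y\<close>. With 2 in the
    middle, both prefixes and the suffix \<open>{y}\<close> are good for either choice; sparsity at
    \<open>{2}\<close> lets \<open>y\<close> be chosen so that the suffix \<open>{2,y}\<close> is
    good too.\<close>
  obtain x y :: int where xy: "x = 0 \<and> y = 1 \<or> x = 1 \<and> y = 0" and Qy: "\<not> suffix_bad f 3 {2,y}"
    using Q02 by (auto simp: insert_commute)
  have good: "\<not> prefix_bad f {x}" "\<not> prefix_bad f {x,2}" "\<not> suffix_bad f 3 {y}"
    using xy P0 P1 P02 P12 Q[of 0 1] Q[of 1 0] by auto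
  define p where "p i = (if i = 0 then x else if i = 1 then 2 else if i = 2 then y else i)" for i :: int
  have img: "p ` {0,1,2} = {0,1,2}" using xy by (auto simp: p_def)
  have "inj_on p {0..<3}" unfolding W using xy by (auto simp: p_def inj_on_def)
  then have "p permutes {0..<3}"
    by (intro bij_imp_permutes) (use img W in \<open>auto simp: bij_betw_def p_def\<close>)
  moreover have "\<not> prefix_bad f (p ` {0..<j}) \<and> \<not> suffix_bad f 3 (p ` {j..<3})"
    if "j \<in> {1..<3}" for j
  proof -
    have sets: "{0..<1::int} = {0}" "{0..<2::int} = {0,1}"
      "{1..<3::int} = {1,2}" "{2..<3::int} = {2}" by auto
    have "j = 1 \<or> j = 2" using that by auto
    then show ?thesis using good Qy by (elim disjE) (simp_all add: sets p_def insert_commute)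
  qed
  ultimately show ?thesis
    by (rule rearrange_window[OF f, where k = 2, rotated 3]) (use r_ge n_ge bad in auto)
qed

section \<open>Existence of an ordering without bad arcs\<close>

lemma ex_ordering: "\<exists>f. ordering f"
proof -
  obtain h where h: "bij_betw h {0..<card E} E" using ex_bij_betw_nat_finite[OF finite_E] by blast
  have "bij_betw nat {0..<n} {0..<card E}"
    by (rule bij_betwI[where g = int]) (auto simp: n_def)
  then have "bij_betw (h \<circ> nat) {0..<n} E" using h by (rule bij_betw_trans)
  then have "bij_betw (\<lambda>x. h (nat (x mod n))) {0..<n} E"
    by (rule bij_betw_cong[THEN iffD1, rotated]) auto
  then show ?thesis by (auto simp: ordering_def intro!: exI[of _ "\<lambda>x. h (nat (x mod n))"])
qed

lemma ex_good_ordering: "\<exists>f. ordering f \<and> (\<forall>i. f ` {i..<i + r} \<notin> H)"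
proof -
  obtain f where f: "ordering f" and min: "\<And>g. ordering g \<Longrightarrow> defects f \<le> defects g"
    using ex_ordering exists_least_iff[of "\<lambda>k. \<exists>f. ordering f \<and> defects f = k"]
    by (metis not_less)
  have "f ` {i..<i + r} \<notin> H" for i
  proof
    assume bad: "f ` {i..<i + r} \<in> H"
    \<comment> \<open>Rotation that brings the bad arc to \<open>{2 - r..<2}\<close>, the place that
      both reductions expect.\<close>
    define h where "h = (\<lambda>x. f (x + (i + r - 2)))"
    have h: "ordering h" "defects h = defects f"
      unfolding h_def using ordering_rotate[OF f] by auto
    have "h ` {2 - r..<2 - r + r} \<in> H" unfolding h_def arc_rotate using bad by simp
    then have "h ` {2 - r..<2} \<in> H" by simp
    moreover have "(3 \<le> r \<and> r + 3 \<le> n) \<or> (r = 2 \<or> n = r + 2)" using r_ge n_ge by linarith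
    ultimately have "\<exists>g. ordering g \<and> defects g < defects h"
      using reduce_wide[OF h(1)] reduce_narrow[OF h(1)] by blast
    then show False using min h(2) by fastforce
  qed
  with f show ?thesis by blast
qed

end

section \<open>Matroids\<close>

lemma mrank_props:
  assumes "matroid E indep"
  shows mrank_witness: "\<exists>X\<subseteq>A. indep X \<and> card X = mrank indep A"
    and indep_le_mrank: "X \<subseteq> A \<Longrightarrow> indep X \<Longrightarrow> card X \<le> mrank indep A"
proof -
  let ?S = "{card X | X. X \<subseteq> A \<and> indep X}"
  have "?S \<subseteq> {..card E}" using assms by (auto simp: matroid_def intro: card_mono)
  then have fin: "finite ?S" by (rule finite_subset) simp
  have "0 \<in> ?S" using assms by (auto simp: matroid_def intro!: exI[of _ "{}"])
  then have "Max ?S \<in> ?S" using fin by (intro Max_in) auto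
  then have "mrank indep A \<in> ?S" unfolding mrank_def .
  then show "\<exists>X\<subseteq>A. indep X \<and> card X = mrank indep A" by (smt (verit) mem_Collect_eq)
  show "card X \<le> mrank indep A" if "X \<subseteq> A" "indep X"
    unfolding mrank_def by (rule Max_ge[OF fin]) (use that in blast)
qed

lemma basis_iff:
  assumes M: "matroid E indep"
  shows "basis E indep B \<longleftrightarrow> indep B \<and> card B = mrank indep E"
proof
  assume B: "basis E indep B"
  then have iB: "indep B" by (simp add: basis_def)
  obtain X where X: "X \<subseteq> E" "indep X" "card X = mrank indep E" using mrank_witness[OF M] by blast
  have "\<not> card B < card X"
  proof
    assume "card B < card X"
    then obtain y where "y \<in> X - B" "indep (insert y B)"
      using M X(2) iB unfolding matroid_def by blast
    then show False using B unfolding basis_def by blast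
  qed
  moreover have "card B \<le> mrank indep E" using indep_le_mrank[OF M _ iB] M iB by (simp add: matroid_def)
  ultimately show "indep B \<and> card B = mrank indep E" using iB X(3) by simp
next
  assume B: "indep B \<and> card B = mrank indep E"
  have "X = B" if "indep X" "B \<subseteq> X" for X
  proof -
    have XE: "X \<subseteq> E" using M that by (simp add: matroid_def)
    then have "finite X" using M by (auto simp: matroid_def intro: finite_subset)
    moreover have "card X \<le> card B" using indep_le_mrank[OF M XE that(1)] B by simp
    ultimately show ?thesis using that(2) card_seteq by metis
  qed
  with B show "basis E indep B" by (simp add: basis_def)
qed

section \<open>Circuits and dependent \<open>r\<close>-sets of sparse paving matroids\<close>

lemma dependent_contains_circuit:
  assumes "finite C" "C \<subseteq> E" "\<not> indep C"
  shows "\<exists>D\<subseteq>C. circuit E indep D"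
  using assms
proof (induction C rule: finite_psubset_induct)
  case (psubset C)
  show ?case
  proof (cases "circuit E indep C")
    case False
    then obtain x where x: "x \<in> C" "\<not> indep (C - {x})" using psubset.prems by (auto simp: circuit_def)
    then have "\<exists>D\<subseteq>C - {x}. circuit E indep D"
      using psubset.prems by (intro psubset.IH) auto
    then show ?thesis by blast
  qed blast
qed

lemma mrank_circuit:
  assumes M: "matroid E indep" and C: "circuit E indep C"
  shows "mrank indep C + 1 = card C"
proof -
  have fin: "finite C" using M C by (auto simp: matroid_def circuit_def intro: finite_subset)
  have "C \<noteq> {}" using M C by (auto simp: matroid_def circuit_def)
  then obtain x where x: "x \<in> C" by blast
  then have "card (C - {x}) \<le> mrank indep C"
    using C by (intro indep_le_mrank[OF M]) (auto simp: circuit_def)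
  moreover obtain X where X: "X \<subseteq> C" "indep X" "card X = mrank indep C" using mrank_witness[OF M] by blast
  have "X \<noteq> C" using X(2) C by (auto simp: circuit_def)
  then have "card X < card C" using X(1) fin by (intro psubset_card_mono) auto
  ultimately show ?thesis using X(3) x fin by simp
qed

text \<open>A circuit \<open>D\<close> inside \<open>C\<close> has rank \<open>card D - 1\<close>,
  so it is nonspanning and therefore a hyperplane. Comparing ranks gives it the size of
  \<open>C\<close>, hence \<open>D = C\<close>.\<close>

lemma sparse_paving_dependent:
  assumes M: "matroid E indep" and S: "sparse_paving E indep"
    and C: "C \<subseteq> E" "card C = mrank indep E" "\<not> indep C"
  shows "circuit E indep C \<and> hyperplane E indep C"
proof -
  have fin: "finite C" using M C by (auto simp: matroid_def intro: finite_subset)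
  obtain D where D: "D \<subseteq> C" "circuit E indep D"
    using dependent_contains_circuit[where indep = indep, OF fin C(1,3)] by blast
  have "card D \<le> card C" using D(1) fin by (rule card_mono[rotated])
  then have "mrank indep D < mrank indep E" using mrank_circuit[OF M D(2)] C(2) by simp
  then have h: "hyperplane E indep D" using S D(2) by (auto simp: sparse_paving_def)
  then have "card D = card C" using mrank_circuit[OF M D(2)] C(2) by (simp add: hyperplane_def)
  then have "D = C" using D(1) fin by (intro card_subset_eq) auto
  with D h show ?thesis by simp
qed

text \<open>Both sets would be circuits. As \<open>insert x U\<close> is a flat, adding
  \<open>y\<close> raises the rank above \<open>card U\<close>, so the independent set
  \<open>U\<close> can be augmented by \<open>x\<close> or \<open>y\<close>, which makes one of the
  two sets independent.\<close>

lemma sparse_paving_sparse: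
  assumes M: "matroid E indep" and S: "sparse_paving E indep"
    and xy: "x \<notin> U" "y \<notin> U" "x \<noteq> y"
    and X: "insert x U \<subseteq> E" "card (insert x U) = mrank indep E" "\<not> indep (insert x U)"
    and Y: "insert y U \<subseteq> E" "card (insert y U) = mrank indep E" "\<not> indep (insert y U)"
  shows False
proof -
  have fin: "finite U" using M X(1) by (auto simp: matroid_def intro: finite_subset)
  have cX: "circuit E indep (insert x U)" "hyperplane E indep (insert x U)"
    using sparse_paving_dependent[OF M S X] by auto
  have iU: "indep U" using cX(1) xy(1) by (auto simp: circuit_def)
  have "mrank indep (insert y (insert x U)) > mrank indep (insert x U)"
    using cX(2) Y(1) xy unfolding hyperplane_def flat_def by blast
  then have big: "mrank indep (insert y (insert x U)) > card U"
    using mrank_circuit[OF M cX(1)] fin xy(1) by simp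
  obtain B where B: "B \<subseteq> insert y (insert x U)" "indep B" "card B > card U"
    using mrank_witness[OF M, of "insert y (insert x U)"] big by metis
  then obtain b where "b \<in> B - U" "indep (insert b U)" using M iU unfolding matroid_def by blast
  then show False using B(1) X(3) Y(3) by blast
qed

section \<open>Necessity of the inequality\<close>

lemma inj_on_add_mod: "inj_on (\<lambda>j. (i + j) mod n) {..<n}" for i n :: nat
proof (rule linorder_inj_onI)
  fix a b assume ab: "a < b" "a \<in> {..<n}" "b \<in> {..<n}"
  then have "\<not> n dvd (i + b) - (i + a)" by (auto dest: dvd_imp_le)
  then show "(i + a) mod n \<noteq> (i + b) mod n"
    using ab(1) mod_eq_dvd_iff_nat[of "i + a" "i + b" n] by auto
qed auto

lemma cyclically_orderable_imp:
  assumes M: "matroid E indep" and O: "cyclically_orderable E indep" and A: "A \<subseteq> E"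
  shows "mrank indep E * card A \<le> mrank indep A * card E"
proof -
  define r where "r = mrank indep E"
  obtain xs where xs: "distinct xs" "set xs = E"
    and B: "\<And>i. i < length xs \<Longrightarrow> basis E indep {xs ! ((i + j) mod length xs) | j. j < r}"
    using O unfolding cyclically_orderable_def r_def by blast
  define n where "n = length xs"
  have n: "card E = n" using xs distinct_card n_def by metis
  \<comment> \<open>\<open>e i j\<close> is the element at offset \<open>j\<close> of the arc
    starting at \<open>i\<close>. Each row of this array lists a basis and so meets \<open>A\<close>
    in an independent set; each column lists \<open>E\<close> once.\<close>
  define e where "e i j = xs ! ((i + j) mod n)" for i j
  have row: "card {j \<in> {..<r}. e i j \<in> A} \<le> mrank indep A" if "i < n" for i
  proof -
    have eq: "{xs ! ((i + j) mod length xs) | j. j < r} = e i ` {..<r}" by (auto simp: e_def n_def)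
    then have b: "indep (e i ` {..<r})" "card (e i ` {..<r}) = r"
      using B[of i] that basis_iff[OF M] by (auto simp: n_def r_def)
    then have "inj_on (e i) {..<r}" by (intro eq_card_imp_inj_on) auto
    then have "card {j \<in> {..<r}. e i j \<in> A} = card (e i ` {j \<in> {..<r}. e i j \<in> A})"
      by (intro card_image[symmetric]) (auto intro: inj_on_subset)
    also have "\<dots> \<le> mrank indep A"
    proof (rule indep_le_mrank[OF M])
      have "e i ` {j \<in> {..<r}. e i j \<in> A} \<subseteq> e i ` {..<r}" by auto
      then show "indep (e i ` {j \<in> {..<r}. e i j \<in> A})" using b(1) M unfolding matroid_def by blast
    qed auto
    finally show ?thesis .
  qed
  have col: "card {i \<in> {..<n}. e i j \<in> A} = card A" for j
  proof -
    have inj: "inj_on (\<lambda>i. (i + j) mod n) {..<n}"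
      using inj_on_add_mod[of j n] by (simp add: add.commute)
    then have "(\<lambda>i. (i + j) mod n) ` {..<n} = {..<n}"
      by (intro card_subset_eq) (auto simp: card_image)
    then have m: "bij_betw (\<lambda>i. (i + j) mod n) {..<n} {..<n}" using inj by (simp add: bij_betw_def)
    have "bij_betw ((!) xs) {..<n} E" using xs n_def by (metis bij_betw_nth)
    then have "bij_betw ((!) xs \<circ> (\<lambda>i. (i + j) mod n)) {..<n} E" using m bij_betw_trans by blast
    then have bij: "bij_betw (\<lambda>i. e i j) {..<n} E" by (simp add: e_def o_def)
    then have "(\<lambda>i. e i j) ` {i \<in> {..<n}. e i j \<in> A} = A"
      using A unfolding bij_betw_def by blast
    moreover have "inj_on (\<lambda>i. e i j) {i \<in> {..<n}. e i j \<in> A}"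
      using bij unfolding bij_betw_def by (auto intro: inj_on_subset)
    ultimately show ?thesis by (metis card_image)
  qed
  have "r * card A = (\<Sum>j<r. card {i \<in> {..<n}. e i j \<in> A})" by (simp only: col) simp
  also have "\<dots> = (\<Sum>i<n. card {j \<in> {..<r}. e i j \<in> A})"
    by (rule sum_multicount_gen) auto
  also have "\<dots> \<le> (\<Sum>i<n. mrank indep A)" by (intro sum_mono row) auto
  finally show ?thesis by (simp add: r_def n mult.commute)
qed

section \<open>Sufficiency of the inequality\<close>

lemma imp_cyclically_orderable:
  assumes M: "matroid E indep" and S: "sparse_paving E indep"
    and ineq: "\<And>A. A \<subseteq> E \<Longrightarrow> A \<noteq> {} \<Longrightarrow> mrank indep E * card A \<le> mrank indep A * card E"
  shows "cyclically_orderable E indep"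
proof -
  define r where "r = mrank indep E"
  define n where "n = card E"
  define H where "H = {C. C \<subseteq> E \<and> card C = r \<and> \<not> indep C}"
  have fin: "finite E" using M by (simp add: matroid_def)
  have rn: "r \<le> n" using mrank_witness[OF M, of E] card_mono[OF fin] unfolding r_def n_def by metis
  have basisI: "basis E indep B" if "B \<subseteq> E" "card B = r" "B \<notin> H" for B
    using that basis_iff[OF M] by (auto simp: H_def r_def)
  obtain xs where xs: "distinct xs" "set xs = E"
    and good: "\<And>i. i < n \<Longrightarrow> {xs ! ((i + j) mod n) | j. j < r} \<notin> H"
  proof (cases "H = {}")
    \<comment> \<open>Every ordering works here. This absorbs all cases with \<open>r < 2\<close> or
      \<open>n < r + 2\<close>.\<close>
    case True
    then show thesis using that finite_distinct_list[OF fin] by blast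
  next
    case False
    then obtain C where C: "C \<subseteq> E" "card C = r" "\<not> indep C" by (auto simp: H_def)
    have ne: "C \<noteq> {}" using C(3) M by (auto simp: matroid_def)
    have "circuit E indep C" using sparse_paving_dependent[OF M S] C by (simp add: r_def)
    then have rC: "mrank indep C + 1 = r" using mrank_circuit[OF M] C(2) by simp
    then obtain k where k: "r = Suc k" "mrank indep C = k" by auto
    \<comment> \<open>The inequality for a single dependent \<open>r\<close>-set, with
      \<open>k = r - 1\<close>. It fails for \<open>k = 0\<close>, and for
      \<open>n \<le> k + 2\<close> because \<open>k * (k + 2)\<close> is one less than the left-hand
      side.\<close>
    have le: "Suc k * Suc k \<le> k * n" using ineq[OF C(1) ne] C(2) k by (simp add: r_def n_def)
    have k0: "k \<noteq> 0" using le by (intro notI) simp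
    have "\<not> n \<le> k + 2"
    proof
      assume "n \<le> k + 2"
      then have "k * n \<le> k * (k + 2)" by (rule mult_le_mono2)
      with le show False by simp
    qed
    then have bounds: "2 \<le> int r" "int r + 2 \<le> int n" using k k0 by auto
    interpret sparse_family E H "int n" "int r"
      using fin bounds sparse_paving_sparse[OF M S]
      by unfold_locales (auto simp: n_def H_def r_def)
    obtain f where f: "ordering f" "\<And>i. f ` {i..<i + int r} \<notin> H" using ex_good_ordering by blast
    define xs where "xs = map (\<lambda>i. f (int i)) [0..<n]"
    have "bij_betw int {0..<n} {0..<int n}" by (rule bij_betwI[where g = nat]) auto
    then have bij: "bij_betw (f \<circ> int) {0..<n} E" using f(1) bij_betw_trans unfolding ordering_def by blast
    have "distinct xs" "set xs = E" using bij by (auto simp: xs_def distinct_map bij_betw_def o_def)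
    moreover have "{xs ! ((i + j) mod n) | j. j < r} \<notin> H" for i
    proof -
      have "xs ! ((i + j) mod n) = f (int i + int j)" for j
      proof -
        have "(i + j) mod n < n" using bounds by simp
        then have "xs ! ((i + j) mod n) = f ((int i + int j) mod int n)"
          by (simp add: xs_def zmod_int)
        then show ?thesis using ordering_mod[OF f(1)] by simp
      qed
      then have "{xs ! ((i + j) mod n) | j. j < r} = f ` (\<lambda>j. int i + int j) ` {..<r}"
        by (auto simp: image_image)
      also have "(\<lambda>j. int i + int j) ` {..<r} = {int i..<int i + int r}"
      proof -
        have "(\<lambda>j. int i + int j) ` {..<r} = (\<lambda>j. int i + j) ` int ` {0..<r}"
          by (simp add: image_image atLeast0LessThan)
        then show ?thesis by (simp add: image_int_atLeastLessThan add.commute)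
      qed
      finally show ?thesis using f(2) by metis
    qed
    ultimately show thesis using that by blast
  qed
  have len: "length xs = n" using xs distinct_card n_def by metis
  show ?thesis unfolding cyclically_orderable_def
  proof (intro exI conjI allI impI)
    show "distinct xs" "set xs = E" by fact+
    fix i assume i: "i < length xs"
    have pos: "0 < n" using i len by simp
    let ?B = "{xs ! ((i + j) mod n) | j. j < r}"
    have img: "?B = (\<lambda>j. xs ! ((i + j) mod n)) ` {..<r}" by auto
    \<comment> \<open>The arc has \<open>r\<close> distinct elements because
      \<open>r \<le> n\<close> keeps the offsets distinct modulo \<open>n\<close>.\<close>
    have "inj_on (\<lambda>j. xs ! ((i + j) mod n)) {..<r}"
    proof (rule inj_onI)
      fix a b assume ab: "a \<in> {..<r}" "b \<in> {..<r}" "xs ! ((i + a) mod n) = xs ! ((i + b) mod n)"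
      then have "(i + a) mod n = (i + b) mod n"
        using xs(1) len pos by (simp add: nth_eq_iff_index_eq)
      then show "a = b" using ab rn inj_onD[OF inj_on_add_mod[of i n], of a b] by simp
    qed
    then have "card ?B = r" unfolding img by (simp add: card_image)
    moreover have "?B \<subseteq> E" using xs(2) len pos by (auto intro: nth_mem)
    ultimately show "basis E indep {xs ! ((i + j) mod length xs) | j. j < mrank indep E}"
      using basisI good[of i] i len by (simp add: r_def)
  qed
qed

theorem theorem2p8:
  fixes E :: "'a set" and indep :: "'a set \<Rightarrow> bool"
  assumes "matroid E indep"
    and "sparse_paving E indep"
  shows "cyclically_orderable E indep \<longleftrightarrow>
         (\<forall>A. A \<subseteq> E \<and> A \<noteq> {} \<longrightarrow>
              mrank indep E * card A \<le> mrank indep A * card E)"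
  using cyclically_orderable_imp[OF assms(1)] imp_cyclically_orderable[OF assms] by blast

end
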